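(* Let the monoid $(\mathcal{M},\ltimes)$ of all real matrices act on the set $\mathcal{V}$ of all real vectors of arbitrary finite dimension by the V-product $(A,x)\mapsto A\,\vec{\ltimes}\,x$. Then $(\mathcal{M},\vec{\ltimes},\mathcal{V})$ is an S-system.
   Context: $\mathbb{N}=\{1,2,\dots\}$; $\mathcal{M}_{m\times n}$ is the set of real $m\times n$ matrices and $\mathcal{M}=\bigcup_{m,n\ge1}\mathcal{M}_{m\times n}$. $\mathcal{V}=\bigcup_{n\ge1}\mathcal{V}_n$ (disjoint union), where $\mathcal{V}_n=\mathbb{R}^n$ (column vectors). $\otimes$ is the Kronecker product, $I_k$ the identity matrix, $\mathbf{1}_k=[1,\dots,1]^T\in\mathbb{R}^k$. M-product: for $A\in\mathcal{M}_{m\times n}$, $B\in\mathcal{M}_{p\times q}$, $t=\operatorname{lcm}(n,p)$: $A\ltimes B:=(A\otimes I_{t/n})(B\otimes I_{t/p})$. With it $\mathcal{M}$ is a monoid with identity the $1\times1$ matrix $1$. V-product: for $A\in\mathcal{M}_{m\times n}$, $x\in\mathcal{V}_r$, $t=\operatorname{lcm}(n,r)$: $A\,\vec{\ltimes}\,x:=(A\otimes I_{t/n})(x\otimes\mathbf{1}_{t/r})$. S-system: given a monoid $(S,* )$ with identity $e$ and a nonempty set $X$, a triple $(S,\varphi,X)$ with $\varphi:S\times X\to X$ is an S-system if $\varphi(g_1,\varphi(g_2,x))=\varphi(g_1*g_2,x)$ and $\varphi(e,x)=x$ for all $g_1,g_2\in S$, $x\in X$. *)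

theory Defs
  imports Complex_Main "HOL-Algebra.Group" "Jordan_Normal_Form.Matrix"
begin

locale S_system = monoid S for S (structure) +
  fixes \<phi> :: "'a \<Rightarrow> 'x \<Rightarrow> 'x" and X :: "'x set"
  assumes nonempty: "X \<noteq> {}"
    and act_closed: "\<lbrakk>g \<in> carrier S; x \<in> X\<rbrakk> \<Longrightarrow> \<phi> g x \<in> X"
    and act_act: "\<lbrakk>g\<^sub>1 \<in> carrier S; g\<^sub>2 \<in> carrier S; x \<in> X\<rbrakk>
      \<Longrightarrow> \<phi> g\<^sub>1 (\<phi> g\<^sub>2 x) = \<phi> (g\<^sub>1 \<otimes> g\<^sub>2) x"
    and act_one: "x \<in> X \<Longrightarrow> \<phi> \<one> x = x"

definition kron_mat :: "real mat \<Rightarrow> real mat \<Rightarrow> real mat" where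
  "kron_mat A B = mat (dim_row A * dim_row B) (dim_col A * dim_col B)
     (\<lambda>(i, j). A $$ (i div dim_row B, j div dim_col B) * B $$ (i mod dim_row B, j mod dim_col B))"

definition kron_vec :: "real vec \<Rightarrow> real vec \<Rightarrow> real vec" where
  "kron_vec x y = vec (dim_vec x * dim_vec y)
     (\<lambda>i. x $ (i div dim_vec y) * y $ (i mod dim_vec y))"

lemma kron_vec_eq_kron_mat:
  "mat_of_cols (dim_vec x * dim_vec y) [kron_vec x y]
     = kron_mat (mat_of_cols (dim_vec x) [x]) (mat_of_cols (dim_vec y) [y])"
proof -
  have "i div dim_vec y < dim_vec x" "i mod dim_vec y < dim_vec y"
    if "i < dim_vec x * dim_vec y" for i
  proof -
    show "i div dim_vec y < dim_vec x"
      using that by (simp add: less_mult_imp_div_less)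
    show "i mod dim_vec y < dim_vec y"
      using that by (intro mod_less_divisor) (rule ccontr, simp del: vec_of_dim_0)
  qed
  then show ?thesis
    by (intro eq_matI) (auto simp: kron_mat_def kron_vec_def mat_of_cols_def)
qed

definition ones_vec :: "nat \<Rightarrow> real vec" where
  "ones_vec k = vec k (\<lambda>_. 1)"

definition M_prod :: "real mat \<Rightarrow> real mat \<Rightarrow> real mat" where
  "M_prod A B = (let t = lcm (dim_col A) (dim_row B) in
     kron_mat A (1\<^sub>m (t div dim_col A)) * kron_mat B (1\<^sub>m (t div dim_row B)))"

definition V_prod :: "real mat \<Rightarrow> real vec \<Rightarrow> real vec" where
  "V_prod A x = (let t = lcm (dim_col A) (dim_vec x) in
     kron_mat A (1\<^sub>m (t div dim_col A)) *\<^sub>v kron_vec x (ones_vec (t div dim_vec x)))"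

text \<open>The library also has matrices and vectors with a dimension 0; these are excluded.\<close>

definition all_mats :: "real mat set" where
  "all_mats = (\<Union>m\<in>{1..}. \<Union>n\<in>{1..}. carrier_mat m n)"

definition all_vecs :: "real vec set" where
  "all_vecs = (\<Union>n\<in>{1..}. carrier_vec n)"

definition mat_monoid :: "real mat monoid" where
  "mat_monoid = \<lparr>carrier = all_mats, mult = M_prod, one = 1\<^sub>m 1\<rparr>"

end

theory Submission
  imports Defs
begin

text \<open>
  Write \<open>A\<close> stretched by \<open>k\<close> for the Kronecker product of \<open>A\<close> with the identity of size \<open>k\<close>.
  Stretching is multiplicative, and stretching by \<open>k\<close> and then by \<open>l\<close> is stretching by \<open>k * l\<close>.
  Hence each bracketing of a triple M-product is a product of three stretched factors, and
  associativity is a statement about the factors alone. For \<open>A\<close> with \<open>n\<close> columns, a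
  \<open>p\<close> by \<open>q\<close> matrix \<open>B\<close> and \<open>C\<close> with \<open>r\<close> rows, the middle factor \<open>l\<close> determines the
  other two, \<open>p * l div n\<close> and \<open>q * l div r\<close>. In both bracketings \<open>l\<close> is the
  least positive number with \<open>n dvd p * l\<close> and \<open>r dvd q * l\<close>, by the arithmetical lemma
  \<open>lcm_mult_absorb\<close>; this gives \<open>M_prod_assoc\<close>.

  The action is a quotient of the multiplication. Let \<open>row_sums\<close> map \<open>Y\<close> to the vector of its
  row sums. It intertwines left multiplication by the M-product with the V-product
  (\<open>V_prod_row_sums\<close>), and each vector is the image of the matrix with that single column.
  The action laws are therefore the images of the associative and the left unit law.
\<close>

section \<open>Stretching a matrix\<close>

definition stretch :: "real mat \<Rightarrow> nat \<Rightarrow> real mat" where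
  "stretch A k = kron_mat A (1\<^sub>m k)"

lemma dim_stretch [simp]:
  "dim_row (stretch A k) = dim_row A * k"
  "dim_col (stretch A k) = dim_col A * k"
  by (simp_all add: stretch_def kron_mat_def)

lemma block_index_less:
  fixes i m k :: nat
  assumes "i < m * k"
  shows "i div k < m" "i mod k < k"
proof -
  show "i div k < m"
    using assms by (rule less_mult_imp_div_less)
  have "k \<noteq> 0" using assms by (metis mult_0_right not_less_zero)
  then show "i mod k < k" by simp
qed

lemma index_stretch:
  assumes "i < dim_row A * k" "j < dim_col A * k"
  shows "stretch A k $$ (i, j) = A $$ (i div k, j div k) * of_bool (i mod k = j mod k)"
  using assms block_index_less[OF assms(1)] block_index_less[OF assms(2)]
  by (simp add: stretch_def kron_mat_def)

lemma stretch_1 [simp]: "stretch A 1 = A"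
  by (rule eq_matI) (simp_all add: index_stretch del: One_nat_def)

lemma stretch_stretch: "stretch (stretch A k) l = stretch A (k * l)"
proof (rule eq_matI, goal_cases)
  case (1 i j)
  then have i: "i < dim_row A * k * l" and j: "j < dim_col A * k * l"
    by (simp_all add: mult.assoc)
  have "i mod (l * k) = j mod (l * k) \<longleftrightarrow> i div l mod k = j div l mod k \<and> i mod l = j mod l"
  proof
    assume *: "i mod (l * k) = j mod (l * k)"
    have "i mod l = j mod l"
      using arg_cong[OF *, of "\<lambda>x. x mod l"] by (simp add: mod_mod_cancel)
    moreover have "l \<noteq> 0" using i by (metis mult_0_right not_less_zero)
    ultimately show "i div l mod k = j div l mod k \<and> i mod l = j mod l"
      using * by (simp add: mod_mult2_eq)
  qed (simp add: mod_mult2_eq)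
  then show ?case
    using i j block_index_less[OF i] block_index_less[OF j]
    by (simp add: index_stretch div_mult2_eq mult.assoc mult.commute[of k l]
        flip: of_bool_conj)
qed (simp_all add: mult.assoc)

text \<open>Each block of \<open>k\<close> consecutive indices contains exactly one index with residue \<open>c\<close>.\<close>

lemma sum_residue_class:
  fixes f :: "nat \<Rightarrow> real"
  assumes "c < k"
  shows "(\<Sum>j<n * k. f (j div k) * of_bool (c = j mod k)) = (\<Sum>a<n. f a)"
proof -
  have "(\<Sum>j<n * k. f (j div k) * of_bool (c = j mod k))
      = (\<Sum>j\<in>(\<lambda>a. a * k + c) ` {..<n}. f (j div k))"
  proof (rule sum.mono_neutral_cong_right)
    show "(\<lambda>a. a * k + c) ` {..<n} \<subseteq> {..<n * k}"
    proof (rule image_subsetI)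
      fix a assume "a \<in> {..<n}"
      then have "(a + 1) * k \<le> n * k" by (intro mult_right_mono) auto
      with assms show "a * k + c \<in> {..<n * k}" by (simp add: algebra_simps)
    qed
    show "\<forall>j\<in>{..<n * k} - (\<lambda>a. a * k + c) ` {..<n}. f (j div k) * of_bool (c = j mod k) = 0"
    proof
      fix j assume j: "j \<in> {..<n * k} - (\<lambda>a. a * k + c) ` {..<n}"
      have "c \<noteq> j mod k"
      proof
        assume "c = j mod k"
        then have "j = j div k * k + c" by simp
        with j block_index_less(1)[of j n k] show False by blast
      qed
      then show "f (j div k) * of_bool (c = j mod k) = 0" by simp
    qed
  qed (use assms in auto)
  also have "\<dots> = (\<Sum>a<n. f a)"
    using assms by (subst sum.reindex) (auto simp: inj_on_def)
  finally show ?thesis .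
qed

lemma stretch_mult:
  assumes AB: "dim_col A = dim_row B"
  shows "stretch (A * B) k = stretch A k * stretch B k"
proof (rule eq_matI, goal_cases)
  case (1 i j)
  then have i: "i < dim_row A * k" and j: "j < dim_col B * k" by simp_all
  let ?f = "\<lambda>a. A $$ (i div k, a) * B $$ (a, j div k) * of_bool (i mod k = j mod k)"
  have "(stretch A k * stretch B k) $$ (i, j)
      = (\<Sum>s<dim_row B * k. stretch A k $$ (i, s) * stretch B k $$ (s, j))"
    using i j AB by (simp add: scalar_prod_def atLeast0LessThan)
  also have "\<dots> = (\<Sum>s<dim_row B * k. ?f (s div k) * of_bool (i mod k = s mod k))"
    using i j AB by (intro sum.cong) (auto simp: index_stretch)
  also have "\<dots> = (\<Sum>a<dim_row B. ?f a)"
    by (rule sum_residue_class) (use block_index_less[OF i] in simp)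
  also have "\<dots> = (\<Sum>a<dim_row B. A $$ (i div k, a) * B $$ (a, j div k))
      * of_bool (i mod k = j mod k)"
    by (simp only: sum_distrib_right)
  also have "\<dots> = stretch (A * B) k $$ (i, j)"
    using i j AB block_index_less[OF i] block_index_less[OF j]
    by (simp add: index_stretch scalar_prod_def atLeast0LessThan)
  finally show ?case ..
qed simp_all

section \<open>The monoid of matrices\<close>

lemma M_prod_stretch:
  "M_prod A B = stretch A (lcm (dim_col A) (dim_row B) div dim_col A)
     * stretch B (lcm (dim_col A) (dim_row B) div dim_row B)"
  by (simp add: M_prod_def stretch_def Let_def)

lemma dim_M_prod [simp]:
  "dim_row (M_prod A B) = dim_row A * (lcm (dim_col A) (dim_row B) div dim_col A)"
  "dim_col (M_prod A B) = dim_col B * (lcm (dim_col A) (dim_row B) div dim_row B)"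
  by (simp_all add: M_prod_stretch)

lemma all_mats_iff: "A \<in> all_mats \<longleftrightarrow> 0 < dim_row A \<and> 0 < dim_col A"
  proof
  assume "0 < dim_row A \<and> 0 < dim_col A"
  then show "A \<in> all_mats"
    unfolding all_mats_def
    by (intro UN_I[of "dim_row A"] UN_I[of "dim_col A"] carrier_matI[OF refl refl]) simp_all
qed (auto simp: all_mats_def)

lemma lcm_div_pos:
  fixes a b :: nat
  assumes "0 < a" "0 < b"
  shows "0 < lcm a b div a" "0 < lcm a b div b"
  using assms by (simp_all add: div_greater_zero_iff dvd_imp_le lcm_pos_nat)

lemma M_prod_closed: "A \<in> all_mats \<Longrightarrow> B \<in> all_mats \<Longrightarrow> M_prod A B \<in> all_mats"
  by (simp add: all_mats_iff lcm_div_pos)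

text \<open>For positive \<open>q\<close> and \<open>r\<close>, a common multiple of \<open>q * a\<close> and \<open>r\<close> is \<open>q * l\<close> with \<open>l\<close>
  divisible by \<open>a\<close> and by the least positive \<open>b\<close> such that \<open>r dvd q * b\<close>. The two conditions on \<open>l\<close> enter symmetrically.\<close>

lemma lcm_mult_absorb:
  fixes q a r :: nat
  shows "lcm (q * a) r = q * lcm a (lcm q r div q)"
proof -
  have "q * lcm a (lcm q r div q) = lcm (q * a) (lcm q r)"
    using lcm_mult_distrib'[of q a "lcm q r div q"] by simp
  also have "\<dots> = lcm (lcm (q * a) q) r"
    by (simp only: lcm.assoc)
  finally show ?thesis by (simp add: lcm_proj1_if_dvd)
qed

text \<open>Since the inner dimensions of the two stretched factors agree, either total factor
  determines the other. This form lets \<open>M_prod_assoc\<close> compare bracketings through the total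
  factor of the middle matrix.\<close>

lemma stretch_M_prod:
  fixes A B c
  defines "t \<equiv> lcm (dim_col A) (dim_row B)"
  assumes pos: "0 < dim_col A" "0 < dim_row B"
  defines "k \<equiv> t div dim_col A * c" and "l \<equiv> t div dim_row B * c"
  shows "stretch (M_prod A B) c = stretch A k * stretch B l"
    and "k = dim_row B * l div dim_col A" and "l = dim_col A * k div dim_row B"
proof -
  have t: "dim_col A * (t div dim_col A) = t" "dim_row B * (t div dim_row B) = t"
    by (simp_all add: t_def)
  then show "stretch (M_prod A B) c = stretch A k * stretch B l"
    by (simp add: M_prod_stretch stretch_mult stretch_stretch k_def l_def flip: t_def)
  have "dim_col A * k = dim_row B * l"
    unfolding k_def l_def using t by (metis mult.assoc)
  then show "k = dim_row B * l div dim_col A" "l = dim_col A * k div dim_row B"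
    using pos by (metis nonzero_mult_div_cancel_left less_not_refl)+
qed

lemma M_prod_assoc:
  assumes "A \<in> all_mats" "B \<in> all_mats" "C \<in> all_mats"
  shows "M_prod (M_prod A B) C = M_prod A (M_prod B C)"
proof -
  let ?n = "dim_col A" and ?p = "dim_row B" and ?q = "dim_col B" and ?r = "dim_row C"
  define a where "a = lcm ?n ?p div ?p"
  define b where "b = lcm ?q ?r div ?q"
  define l where "l = lcm a b"
  have pos: "0 < ?n" "0 < ?p" "0 < ?q" "0 < ?r" "0 < a" "0 < b"
    using assms by (auto simp: all_mats_iff a_def b_def lcm_div_pos)
  have al: "a * (l div a) = l" and bl: "b * (l div b) = l"
    by (simp_all add: l_def)
  have t1: "lcm (?q * a) ?r = ?q * l"
    by (simp add: lcm_mult_absorb l_def b_def)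
  have t2: "lcm ?n (?p * b) = ?p * l"
    by (metis lcm_mult_absorb lcm.commute l_def a_def)

  have "M_prod (M_prod A B) C = stretch (M_prod A B) (l div a) * stretch C (?q * l div ?r)"
    using t1 pos by (subst M_prod_stretch) (simp flip: a_def)
  also have "stretch (M_prod A B) (l div a) = stretch A (?p * l div ?n) * stretch B l"
    using stretch_M_prod(1,2)[OF pos(1,2), of "l div a"] by (simp add: al flip: a_def)
  finally have left: "M_prod (M_prod A B) C
      = stretch A (?p * l div ?n) * stretch B l * stretch C (?q * l div ?r)" .

  have "M_prod A (M_prod B C) = stretch A (?p * l div ?n) * stretch (M_prod B C) (l div b)"
    using t2 pos by (subst M_prod_stretch) (simp flip: b_def)
  also have "stretch (M_prod B C) (l div b) = stretch B l * stretch C (?q * l div ?r)"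
    using stretch_M_prod(1,3)[OF pos(3,4), of "l div b"] by (simp add: bl flip: b_def)
  finally have right: "M_prod A (M_prod B C)
      = stretch A (?p * l div ?n) * (stretch B l * stretch C (?q * l div ?r))" .

  have "?n dvd ?p * l" "?r dvd ?q * l"
    by (metis t2 dvd_lcm1) (metis t1 dvd_lcm2)
  then show ?thesis
    unfolding left right
    by (subst assoc_mult_mat[OF carrier_matI[OF refl refl]
          carrier_matI[OF _ refl] carrier_matI[OF _ refl]]) simp_all
qed

lemma stretch_one_mat [simp]: "stretch (1\<^sub>m 1) k = 1\<^sub>m k"
  by (rule eq_matI) (auto simp: index_stretch)

lemma one_M_prod: "A \<in> all_mats \<Longrightarrow> M_prod (1\<^sub>m 1) A = A"
  by (simp add: M_prod_stretch all_mats_iff del: One_nat_def)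

lemma M_prod_one: "A \<in> all_mats \<Longrightarrow> M_prod A (1\<^sub>m 1) = A"
  by (simp add: M_prod_stretch all_mats_iff del: One_nat_def)

lemma monoid_mat_monoid: "monoid mat_monoid"
  by (rule monoidI)
    (simp_all add: mat_monoid_def M_prod_closed M_prod_assoc one_M_prod M_prod_one
      all_mats_iff[of "1\<^sub>m _"] del: One_nat_def)

section \<open>Vectors as row sums\<close>

definition row_sums :: "real mat \<Rightarrow> real vec" where
  "row_sums Y = Y *\<^sub>v ones_vec (dim_col Y)"

lemma dim_row_sums [simp]: "dim_vec (row_sums Y) = dim_row Y"
  by (simp add: row_sums_def)

lemma index_row_sums: "i < dim_row Y \<Longrightarrow> row_sums Y $ i = (\<Sum>j<dim_col Y. Y $$ (i, j))"
  by (simp add: row_sums_def ones_vec_def scalar_prod_def atLeast0LessThan)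

lemma kron_vec_row_sums: "kron_vec (row_sums Y) (ones_vec k) = row_sums (stretch Y k)"
proof (rule eq_vecI, goal_cases)
  case (1 i)
  then have i: "i < dim_row Y * k" by simp
  have "row_sums (stretch Y k) $ i
      = (\<Sum>j<dim_col Y * k. Y $$ (i div k, j div k) * of_bool (i mod k = j mod k))"
    using i by (simp add: index_row_sums index_stretch)
  also have "\<dots> = (\<Sum>a<dim_col Y. Y $$ (i div k, a))"
    by (rule sum_residue_class) (use block_index_less[OF i] in simp)
  also have "\<dots> = kron_vec (row_sums Y) (ones_vec k) $ i"
    using i block_index_less[OF i] by (simp add: kron_vec_def ones_vec_def index_row_sums)
  finally show ?case ..
qed (simp add: kron_vec_def ones_vec_def)

text \<open>Row sums commute with stretching, and the number of columns of \<open>Y\<close> does not enter the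
  stretching factors of either product. What remains is associativity of the ordinary matrix
  product applied to the all-ones vector.\<close>

lemma V_prod_row_sums: "V_prod A (row_sums Y) = row_sums (M_prod A Y)"
proof -
  let ?t = "lcm (dim_col A) (dim_row Y)"
  let ?A = "stretch A (?t div dim_col A)" and ?Y = "stretch Y (?t div dim_row Y)"
  have "V_prod A (row_sums Y) = ?A *\<^sub>v row_sums ?Y"
    by (simp add: V_prod_def Let_def kron_vec_row_sums flip: stretch_def)
  also have "\<dots> = (?A * ?Y) *\<^sub>v ones_vec (dim_col ?Y)"
    unfolding row_sums_def
    by (subst assoc_mult_mat_vec[OF carrier_matI[OF refl refl]
          carrier_matI[OF _ refl] carrier_vecI]) (simp_all add: ones_vec_def)
  also have "\<dots> = row_sums (M_prod A Y)"
    by (simp add: row_sums_def M_prod_stretch)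
  finally show ?thesis .
qed

lemma all_vecs_row_sums: "all_vecs = row_sums ` all_mats"
proof (intro equalityI subsetI)
  fix x assume "x \<in> all_vecs"
  then have "0 < dim_vec x" by (auto simp: all_vecs_def)
  then have "mat_of_cols (dim_vec x) [x] \<in> all_mats" by (simp add: all_mats_iff)
  moreover have "x = row_sums (mat_of_cols (dim_vec x) [x])"
    by (rule eq_vecI) (simp_all add: index_row_sums mat_of_cols_def)
  ultimately show "x \<in> row_sums ` all_mats" by blast
next
  fix x assume "x \<in> row_sums ` all_mats"
  then have "0 < dim_vec x" by (auto simp: all_mats_iff)
  then show "x \<in> all_vecs" unfolding all_vecs_def by (intro UN_I[of "dim_vec x"] carrier_vecI[OF refl]) simp
qed

theorem mainTheorem2:
  shows "S_system mat_monoid V_prod all_vecs"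
proof (intro S_system.intro S_system_axioms.intro)
  show "monoid mat_monoid" by (rule monoid_mat_monoid)
  have "1\<^sub>m 1 \<in> all_mats" by (simp add: all_mats_iff)
  then show "all_vecs \<noteq> {}" by (auto simp: all_vecs_row_sums)
qed (auto simp: mat_monoid_def all_vecs_row_sums V_prod_row_sums M_prod_closed M_prod_assoc
    one_M_prod simp del: One_nat_def)

end
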